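(* Let $\alpha_1, A_1, \alpha_2, A_2 > 0$ and consider the system of difference equations $$x_{n+1}=\frac{\alpha_{1}}{A_{1}+y_{n}},\qquad y_{n+1}=\frac{\alpha_{2}}{A_{2}+y_{n}},\qquad n=0,1,2,\dots,$$ with arbitrary nonnegative initial conditions $x_0,y_0$. There is a unique nonnegative equilibrium, and it is globally asymptotically stable.
   Context: The state space is $[0,\infty)^2$. A nonnegative equilibrium is a point $(\bar x,\bar y)\in[0,\infty)^2$ such that the constant sequence $(x_n,y_n)=(\bar x,\bar y)$ solves the system. It is globally asymptotically stable if it is Lyapunov stable relative to $[0,\infty)^2$ (for every $\varepsilon>0$ there is $\delta>0$ such that every initial condition in $[0,\infty)^2$ within $\delta$ of $(\bar x,\bar y)$ has its whole orbit within $\varepsilon$ of $(\bar x,\bar y)$) and every solution with initial condition in $[0,\infty)^2$ converges to $(\bar x,\bar y)$. *)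

theory Defs
  imports "HOL-Analysis.Analysis"
begin

definition quadrant :: "(real \<times> real) set" where
  "quadrant = {0..} \<times> {0..}"

definition rational_map :: "real \<Rightarrow> real \<Rightarrow> real \<Rightarrow> real \<Rightarrow> real \<times> real \<Rightarrow> real \<times> real" where
  "rational_map \<alpha>1 A1 \<alpha>2 A2 = (\<lambda>(x, y). (\<alpha>1 / (A1 + y), \<alpha>2 / (A2 + y)))"

definition solves :: "('a \<Rightarrow> 'a) \<Rightarrow> (nat \<Rightarrow> 'a) \<Rightarrow> bool" where
  "solves F z \<longleftrightarrow> (\<forall>n. z (Suc n) = F (z n))"

definition equilibrium :: "'a set \<Rightarrow> ('a \<Rightarrow> 'a) \<Rightarrow> 'a \<Rightarrow> bool" where
  "equilibrium S F p \<longleftrightarrow> p \<in> S \<and> solves F (\<lambda>n. p)"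

definition lyapunov_stable :: "'a::metric_space set \<Rightarrow> ('a \<Rightarrow> 'a) \<Rightarrow> 'a \<Rightarrow> bool" where
  "lyapunov_stable S F p \<longleftrightarrow>
     (\<forall>\<epsilon>>0. \<exists>\<delta>>0. \<forall>z. solves F z \<and> z 0 \<in> S \<and> dist (z 0) p < \<delta> \<longrightarrow>
        (\<forall>n. dist (z n) p < \<epsilon>))"

definition globally_attracting :: "'a::metric_space set \<Rightarrow> ('a \<Rightarrow> 'a) \<Rightarrow> 'a \<Rightarrow> bool" where
  "globally_attracting S F p \<longleftrightarrow> (\<forall>z. solves F z \<and> z 0 \<in> S \<longrightarrow> z \<longlonglongrightarrow> p)"

definition globally_asymptotically_stable ::
    "'a::metric_space set \<Rightarrow> ('a \<Rightarrow> 'a) \<Rightarrow> 'a \<Rightarrow> bool" where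
  "globally_asymptotically_stable S F p \<longleftrightarrow> lyapunov_stable S F p \<and> globally_attracting S F p"

end

theory Submission
  imports Defs
begin

text \<open>
  The second equation is autonomous. The deviation of \<open>y\<^sub>n\<close> from a fixed point \<open>v\<close> is multiplied by
  \<open>-v / (A\<^sub>2 + y\<^sub>n)\<close> in each step. This factor may exceed 1 in modulus, but the product of two
  consecutive factors is \<open>v\<^sup>2 / (\<alpha>\<^sub>2 + A\<^sub>2 (A\<^sub>2 + y\<^sub>n))\<close>, and \<open>v\<^sup>2 = \<alpha>\<^sub>2 - A\<^sub>2 v < \<alpha>\<^sub>2\<close>, so every two
  steps contract by the uniform factor \<open>\<alpha>\<^sub>2 / (\<alpha>\<^sub>2 + A\<^sub>2\<^sup>2) < 1\<close>. The first component is a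
  Lipschitz function of the preceding \<open>y\<close>. The resulting geometric bound, linear in the initial
  distance, gives stability and attraction, and attraction forces uniqueness of the equilibrium.
\<close>

text \<open>A convergent sequence is bounded, say by \<open>C\<close>, so \<delta> = \<epsilon> /
  \<open>C\<close> witnesses stability. Attraction follows by squeezing the distance between 0 and a
  null sequence.\<close>

lemma globally_asymptotically_stable_if_uniform_decay:
  fixes p :: "'a::metric_space"
  assumes bound: "\<And>z n. solves F z \<Longrightarrow> z 0 \<in> S \<Longrightarrow> dist (z n) p \<le> c n * dist (z 0) p"
    and lim: "c \<longlonglongrightarrow> (0::real)"
  shows "globally_asymptotically_stable S F p"
proof -
  obtain C where C: "C > 0" "\<And>n. norm (c n) \<le> C"
    using lim by (meson convergentI convergent_imp_Bseq BseqE)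
  have "lyapunov_stable S F p"
    unfolding lyapunov_stable_def
  proof (intro allI impI)
    fix \<epsilon> :: real
    assume "\<epsilon> > 0"
    have "dist (z n) p < \<epsilon>" if z: "solves F z" "z 0 \<in> S" "dist (z 0) p < \<epsilon> / C" for z n
    proof -
      have "dist (z n) p \<le> c n * dist (z 0) p"
        using bound z by blast
      also have "\<dots> \<le> C * dist (z 0) p"
        using C(2)[of n] by (intro mult_right_mono) auto
      also have "\<dots> < \<epsilon>"
        using z(3) C(1) by (simp add: field_simps)
      finally show ?thesis .
    qed
    then show "\<exists>\<delta>>0. \<forall>z. solves F z \<and> z 0 \<in> S \<and> dist (z 0) p < \<delta> \<longrightarrow> (\<forall>n. dist (z n) p < \<epsilon>)"
      using C(1) \<open>\<epsilon> > 0\<close> by (intro exI[of _ "\<epsilon> / C"]) auto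
  qed
  moreover have "globally_attracting S F p"
    unfolding globally_attracting_def
  proof (intro allI impI)
    fix z
    assume z: "solves F z \<and> z 0 \<in> S"
    have "(\<lambda>n. dist (z n) p) \<longlonglongrightarrow> 0"
      by (rule real_tendsto_sandwich[OF _ _ tendsto_const
            tendsto_mult_left_zero[OF lim, of "dist (z 0) p"]])
        (use bound z in auto)
    then show "z \<longlonglongrightarrow> p"
      by (simp add: tendsto_dist_iff[of z])
  qed
  ultimately show ?thesis
    by (simp add: globally_asymptotically_stable_def)
qed

text \<open>The constant sequence at \<open>q\<close> is a solution starting in \<open>S\<close>, so
  it converges to \<open>p\<close> as well as to \<open>q\<close>.\<close>

lemma equilibrium_unique_if_attracting:
  assumes "globally_attracting S F p" "equilibrium S F q"
  shows "q = p"
  using assms LIMSEQ_unique[OF tendsto_const]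
  unfolding globally_attracting_def equilibrium_def by blast

text \<open>The quotient \<open>a / (A + v)\<close> is kept intact on the right because at an
  equilibrium it is one of the coordinates: \<open>v\<close> for the second equation,
  \<open>u\<close> for the first.\<close>

lemma abs_divide_add_diff:
  fixes a A v y :: real
  assumes "A > 0" "v \<ge> 0" "y \<ge> 0" "a \<ge> 0"
  shows "\<bar>a / (A + y) - a / (A + v)\<bar> = a / (A + v) / (A + y) * \<bar>y - v\<bar>"
proof -
  have "a / (A + y) - a / (A + v) = - (a / (A + v) / (A + y) * (y - v))"
    using assms by (simp add: divide_simps) (simp add: algebra_simps)
  then show ?thesis
    using assms by (simp add: abs_mult)
qed

lemma divide_add_two_step_contraction:
  fixes a A v y :: real
  assumes "a > 0" "A > 0" "v \<ge> 0" "y \<ge> 0" and v: "v = a / (A + v)"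
  shows "\<bar>a / (A + a / (A + y)) - v\<bar> \<le> a / (a + A\<^sup>2) * \<bar>y - v\<bar>"
proof -
  define w where "w = a / (A + y)"
  have pos: "w > 0" "A + y > 0" "A + v > 0"
    using assms by (auto simp: w_def intro!: divide_pos_pos)
  have step: "\<bar>a / (A + u) - v\<bar> = v / (A + u) * \<bar>u - v\<bar>" if "u \<ge> 0" for u
    using abs_divide_add_diff[of A v u a] assms that by (simp flip: v)
  have "\<bar>a / (A + w) - v\<bar> = v / (A + w) * (v / (A + y) * \<bar>y - v\<bar>)"
    using step[of w] step[of y] pos assms by (simp add: w_def)
  also have "\<dots> = v\<^sup>2 / ((A + w) * (A + y)) * \<bar>y - v\<bar>"
    by (simp add: power2_eq_square)
  \<comment> \<open>Since \<open>w * (A + y) = a\<close>, the intermediate iterate drops out of the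
    denominator.\<close>
  also have "(A + w) * (A + y) = a + A * (A + y)"
    using pos by (simp add: w_def field_simps)
  also have "v\<^sup>2 / (a + A * (A + y)) * \<bar>y - v\<bar> \<le> a / (a + A\<^sup>2) * \<bar>y - v\<bar>"
  proof (intro mult_right_mono frac_le)
    have "v * (A + v) = a"
      using v pos by (simp add: eq_divide_eq)
    then have "v\<^sup>2 + A * v = a"
      by (simp add: power2_eq_square algebra_simps)
    then show "v\<^sup>2 \<le> a"
      using assms mult_nonneg_nonneg[of A v] by linarith
    show "a + A\<^sup>2 \<le> a + A * (A + y)"
      using assms by (simp add: power2_eq_square algebra_simps)
  qed (use assms in \<open>auto intro: add_pos_nonneg\<close>)
  finally show ?thesis
    by (simp add: w_def)
qed

text \<open>Even and odd indices form separate chains of two-step contractions. The odd chain starts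
  after one step, which may expand by up to \<open>v / A\<close>; the constant
  \<open>1 + v / A\<close> covers both starts.\<close>

lemma divide_add_orbit_bound:
  fixes a A v :: real and y :: "nat \<Rightarrow> real"
  assumes "a > 0" "A > 0" "v \<ge> 0" and v: "v = a / (A + v)"
    and y: "\<And>n. y (Suc n) = a / (A + y n)" "y 0 \<ge> 0"
  shows "\<bar>y n - v\<bar> \<le> (1 + v / A) * (a / (a + A\<^sup>2)) ^ (n div 2) * \<bar>y 0 - v\<bar>"
proof -
  define r where "r = a / (a + A\<^sup>2)"
  have "r \<ge> 0"
    using assms by (simp add: r_def)
  have nonneg: "y n \<ge> 0" for n
    by (induction n) (use assms in auto)
  show ?thesis
    unfolding r_def[symmetric]
  proof (induction n rule: induct_nat_012)
    case 0
    show ?case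
      using assms by (simp add: mult_le_cancel_right1)
  next
    case 1
    have "\<bar>y (Suc 0) - v\<bar> = v / (A + y 0) * \<bar>y 0 - v\<bar>"
      using abs_divide_add_diff[of A v "y 0" a] assms by (simp flip: v)
    also have "\<dots> \<le> (1 + v / A) * \<bar>y 0 - v\<bar>"
      using frac_le[of v v A "A + y 0"] assms by (intro mult_right_mono) auto
    finally show ?case
      by simp
  next
    case (ge2 n)
    have "\<bar>y (Suc (Suc n)) - v\<bar> \<le> r * \<bar>y n - v\<bar>"
      using divide_add_two_step_contraction[of a A v "y n"] nonneg assms by (simp add: r_def)
    also have "\<dots> \<le> r * ((1 + v / A) * r ^ (n div 2) * \<bar>y 0 - v\<bar>)"
      using ge2 \<open>r \<ge> 0\<close> by (intro mult_left_mono)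
    finally show ?case
      by (simp add: mult_ac)
  qed
qed

lemma equilibrium_rational_map_iff:
  "equilibrium quadrant (rational_map \<alpha>1 A1 \<alpha>2 A2) (u, v) \<longleftrightarrow>
     u \<ge> 0 \<and> v \<ge> 0 \<and> u = \<alpha>1 / (A1 + v) \<and> v = \<alpha>2 / (A2 + v)"
  by (auto simp: equilibrium_def quadrant_def solves_def rational_map_def)

lemma equilibrium_rational_map_exists:
  assumes "\<alpha>1 > 0" "A1 > 0" "\<alpha>2 > 0" "A2 > 0"
  shows "\<exists>p. equilibrium quadrant (rational_map \<alpha>1 A1 \<alpha>2 A2) p"
proof -
  \<comment> \<open>The positive root of \<open>v\<^sup>2 + A2 * v = \<alpha>2\<close>, the fixed
    point equation with its denominator cleared.\<close>
  define v where "v = (sqrt (A2\<^sup>2 + 4 * \<alpha>2) - A2) / 2"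
  have "v > 0"
    using assms by (auto simp: v_def intro: real_less_rsqrt)
  have "2 * v + A2 = sqrt (A2\<^sup>2 + 4 * \<alpha>2)"
    by (simp add: v_def field_simps)
  then have "(2 * v + A2)\<^sup>2 = A2\<^sup>2 + 4 * \<alpha>2"
    using assms by simp
  then have "v * (A2 + v) = \<alpha>2"
    by (simp add: power2_eq_square algebra_simps)
  then have "v = \<alpha>2 / (A2 + v)"
    using \<open>v > 0\<close> assms by (simp add: eq_divide_eq)
  then show ?thesis
    using \<open>v > 0\<close> assms equilibrium_rational_map_iff[of \<alpha>1 A1 \<alpha>2 A2 "\<alpha>1 / (A1 + v)" v] by auto
qed

text \<open>The exponent uses \<open>n - 1\<close> because the first component at time
  \<open>n\<close> is controlled by the second at time \<open>n - 1\<close>. In the factor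
  \<open>1 + u / A1\<close>, the summand \<open>u / A1\<close> pays for the first component and 1
  for the second.\<close>

lemma rational_map_orbit_bound:
  fixes \<alpha>1 A1 \<alpha>2 A2 u v :: real
  assumes pos: "\<alpha>1 > 0" "A1 > 0" "\<alpha>2 > 0" "A2 > 0"
    and eq: "equilibrium quadrant (rational_map \<alpha>1 A1 \<alpha>2 A2) (u, v)"
    and z: "solves (rational_map \<alpha>1 A1 \<alpha>2 A2) z" "z 0 \<in> quadrant"
  shows "dist (z n) (u, v) \<le>
    (1 + u / A1) * (1 + v / A2) * (\<alpha>2 / (\<alpha>2 + A2\<^sup>2)) ^ ((n - 1) div 2) * dist (z 0) (u, v)"
proof -
  define r where "r = \<alpha>2 / (\<alpha>2 + A2\<^sup>2)"
  have r: "0 \<le> r" "r \<le> 1"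
    using pos by (auto simp: r_def divide_le_eq_1 add_pos_pos)
  have uv: "u \<ge> 0" "v \<ge> 0" "u = \<alpha>1 / (A1 + v)" "v = \<alpha>2 / (A2 + v)"
    using eq unfolding equilibrium_rational_map_iff by blast+
  define x y where "x = (\<lambda>n. fst (z n))" and "y = (\<lambda>n. snd (z n))"
  have xy: "x (Suc n) = \<alpha>1 / (A1 + y n)" "y (Suc n) = \<alpha>2 / (A2 + y n)" for n
    using z(1) by (auto simp: x_def y_def solves_def rational_map_def case_prod_beta)
  have y0: "y 0 \<ge> 0"
    using z(2) by (auto simp: y_def quadrant_def)
  have y_nonneg: "y n \<ge> 0" for n
    by (induction n) (use pos y0 xy in auto)
  define B where "B = (\<lambda>m. (1 + v / A2) * r ^ (m div 2) * dist (z 0) (u, v))"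
  have B_nonneg: "B m \<ge> 0" for m
    using uv pos r by (simp add: B_def)
  have y_bound: "\<bar>y m - v\<bar> \<le> B m" for m
  proof -
    have "\<bar>y m - v\<bar> \<le> (1 + v / A2) * r ^ (m div 2) * \<bar>y 0 - v\<bar>"
      unfolding r_def using pos uv xy y0 by (intro divide_add_orbit_bound)
    also have "\<dots> \<le> B m"
      unfolding B_def using uv pos r dist_snd_le[of "z 0" "(u, v)"]
      by (intro mult_left_mono) (auto simp: y_def dist_real_def)
    finally show ?thesis .
  qed
  show ?thesis
  proof (cases n)
    case 0
    \<comment> \<open>At \<open>n = 0\<close> truncated subtraction makes the exponent 0, so it
      suffices that the constant is at least 1.\<close>
    have "1 * 1 \<le> (1 + u / A1) * (1 + v / A2)"
      using uv pos by (intro mult_mono) auto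
    then have "1 * dist (z 0) (u, v) \<le> (1 + u / A1) * (1 + v / A2) * dist (z 0) (u, v)"
      by (intro mult_right_mono) auto
    then show ?thesis
      using 0 by simp
  next
    case (Suc m)
    have "\<bar>x (Suc m) - u\<bar> = u / (A1 + y m) * \<bar>y m - v\<bar>"
      using abs_divide_add_diff[of A1 v "y m" \<alpha>1] pos uv y_nonneg xy by simp
    also have "\<dots> \<le> u / A1 * B m"
      using y_bound[of m] y_nonneg[of m] pos uv by (intro mult_mono frac_le) auto
    finally have x: "\<bar>x (Suc m) - u\<bar> \<le> u / A1 * B m" .
    \<comment> \<open>The bound on the second component is weakened to index \<open>m\<close>, to
      match the one on the first.\<close>
    have "r ^ (Suc m div 2) \<le> r ^ (m div 2)"
      using r by (intro power_decreasing) auto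
    then have "B (Suc m) \<le> B m"
      unfolding B_def using uv pos by (intro mult_right_mono mult_left_mono) auto
    then have y: "\<bar>y (Suc m) - v\<bar> \<le> B m"
      using y_bound[of "Suc m"] by linarith
    have "dist (z n) (u, v) \<le> \<bar>x (Suc m) - u\<bar> + \<bar>y (Suc m) - v\<bar>"
      using sqrt_sum_squares_le_sum_abs[of "x (Suc m) - u" "y (Suc m) - v"]
      by (simp add: Suc x_def y_def dist_prod_def dist_real_def)
    also have "\<dots> \<le> (1 + u / A1) * B m"
      using x y by (simp add: algebra_simps)
    finally show ?thesis
      by (simp add: Suc B_def r_def mult_ac)
  qed
qed

lemma rational_map_globally_asymptotically_stable:
  fixes \<alpha>1 A1 \<alpha>2 A2 :: real
  assumes pos: "\<alpha>1 > 0" "A1 > 0" "\<alpha>2 > 0" "A2 > 0"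
    and eq: "equilibrium quadrant (rational_map \<alpha>1 A1 \<alpha>2 A2) p"
  shows "globally_asymptotically_stable quadrant (rational_map \<alpha>1 A1 \<alpha>2 A2) p"
proof -
  obtain u v where p: "p = (u, v)"
    by (cases p)
  define r where "r = \<alpha>2 / (\<alpha>2 + A2\<^sup>2)"
  have "0 \<le> r" "r < 1"
    using pos by (auto simp: r_def add_pos_pos)
  then have "(\<lambda>n. r ^ n) \<longlonglongrightarrow> 0"
    by (rule LIMSEQ_realpow_zero)
  moreover have "filterlim (\<lambda>n::nat. (n - 1) div 2) sequentially sequentially"
    unfolding filterlim_at_top
  proof
    fix k :: nat
    show "\<forall>\<^sub>F n in sequentially. k \<le> (n - 1) div 2"
      using eventually_ge_at_top[of "2 * k + 1"] by eventually_elim linarith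
  qed
  ultimately have "(\<lambda>n. r ^ ((n - 1) div 2)) \<longlonglongrightarrow> 0"
    by (rule filterlim_compose)
  then have "(\<lambda>n. (1 + u / A1) * (1 + v / A2) * r ^ ((n - 1) div 2)) \<longlonglongrightarrow> 0"
    by (rule tendsto_mult_right_zero)
  with rational_map_orbit_bound[OF pos eq[unfolded p]] show ?thesis
    unfolding p r_def by (rule globally_asymptotically_stable_if_uniform_decay)
qed

theorem theorem8:
  fixes \<alpha>1 A1 \<alpha>2 A2 :: real
  assumes "\<alpha>1 > 0" and "A1 > 0" and "\<alpha>2 > 0" and "A2 > 0"
  shows "(\<exists>!p. equilibrium quadrant (rational_map \<alpha>1 A1 \<alpha>2 A2) p) \<and>
         (\<forall>p. equilibrium quadrant (rational_map \<alpha>1 A1 \<alpha>2 A2) p \<longrightarrow>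
              globally_asymptotically_stable quadrant (rational_map \<alpha>1 A1 \<alpha>2 A2) p)"
  \<comment> \<open>Every equilibrium is globally attracting, so any two coincide.\<close>
  using equilibrium_rational_map_exists[OF assms]
    rational_map_globally_asymptotically_stable[OF assms] equilibrium_unique_if_attracting
  unfolding globally_asymptotically_stable_def by metis

end
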